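(* Let $X$ be a compactum and let $\gamma$ be a non-atomic subadditive capacity on $X$. If $\gamma$ is not thin, then there is a $G_{\delta\sigma}$-set $M$ in $X$ such that: (i) there is no $G_\delta$-set $G$ in $X$ with $M\subseteq G$ and $\gamma(G\setminus M)=0$; (ii) there is a subadditive capacity $\gamma'\ll\gamma$ on $X$ such that $\gamma'(M)=0$ but $M$ is not contained in any $\gamma'$-null $G_\delta$-set in $X$.
   Context: A compactum is a compact metrizable space. A capacity on $X$ is a function $\gamma:\mathcal P(X)\to[0,+\infty)$, defined on all subsets of $X$, such that (1) $\gamma(\emptyset)=0$ and $A\subseteq B$ implies $\gamma(A)\le\gamma(B)$; (2) $\gamma(\bigcup_n A_n)=\sup_n\gamma(A_n)$ whenever $A_0\subseteq A_1\subseteq A_2\subseteq\dots$; (3) $\gamma(\bigcap_n K_n)=\inf_n\gamma(K_n)$ whenever $K_0\supseteq K_1\supseteq K_2\supseteq\dots$ are compact sets. It is subadditive if $\gamma(A\cup B)\le\gamma(A)+\gamma(B)$ for all $A,B\subseteq X$. It is thin if there is no uncountable family of pairwise disjoint compact subsets of $X$ of positive capacity. Non-atomic means $\gamma(\{x\})=0$ for every $x\in X$. $\gamma'\ll\gamma$ means that $\gamma(A)=0$ implies $\gamma'(A)=0$. A set $A$ is $\gamma'$-null if $\gamma'(A)=0$. A $G_{\delta\sigma}$-set is a countable union of $G_\delta$-sets. *)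

theory Defs
  imports "HOL-Analysis.Analysis"
begin

text \<open>
  A set function on the subsets of \<^term>\<open>topspace X\<close> is represented by a total function on
  \<^typ>\<open>'a set\<close>; only its values on subsets of \<^term>\<open>topspace X\<close> are ever constrained or used.
  Monotonicity bounds the values by the one on \<^term>\<open>topspace X\<close>, so the conditionally complete
  \<open>SUP\<close> and \<open>INF\<close> over the reals below are genuine suprema and infima.
\<close>

definition capacity_on :: "'a topology \<Rightarrow> ('a set \<Rightarrow> real) \<Rightarrow> bool" where
  "capacity_on X \<gamma> \<longleftrightarrow>
     (\<forall>A \<subseteq> topspace X. 0 \<le> \<gamma> A) \<and>
     \<gamma> {} = 0 \<and>
     (\<forall>A B. A \<subseteq> B \<and> B \<subseteq> topspace X \<longrightarrow> \<gamma> A \<le> \<gamma> B) \<and>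
     (\<forall>A :: nat \<Rightarrow> 'a set. incseq A \<and> (\<forall>n. A n \<subseteq> topspace X) \<longrightarrow>
        \<gamma> (\<Union>n. A n) = (SUP n. \<gamma> (A n))) \<and>
     (\<forall>K :: nat \<Rightarrow> 'a set. decseq K \<and> (\<forall>n. compactin X (K n)) \<longrightarrow>
        \<gamma> (\<Inter>n. K n) = (INF n. \<gamma> (K n)))"

definition subadditive_on :: "'a topology \<Rightarrow> ('a set \<Rightarrow> real) \<Rightarrow> bool" where
  "subadditive_on X \<gamma> \<longleftrightarrow>
     (\<forall>A B. A \<subseteq> topspace X \<and> B \<subseteq> topspace X \<longrightarrow> \<gamma> (A \<union> B) \<le> \<gamma> A + \<gamma> B)"

definition thin_on :: "'a topology \<Rightarrow> ('a set \<Rightarrow> real) \<Rightarrow> bool" where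
  "thin_on X \<gamma> \<longleftrightarrow>
     \<not> (\<exists>\<K>. uncountable \<K> \<and> pairwise disjnt \<K> \<and> (\<forall>K\<in>\<K>. compactin X K \<and> \<gamma> K > 0))"

definition nonatomic_on :: "'a topology \<Rightarrow> ('a set \<Rightarrow> real) \<Rightarrow> bool" where
  "nonatomic_on X \<gamma> \<longleftrightarrow> (\<forall>x \<in> topspace X. \<gamma> {x} = 0)"

definition abs_cont_on :: "'a topology \<Rightarrow> ('a set \<Rightarrow> real) \<Rightarrow> ('a set \<Rightarrow> real) \<Rightarrow> bool" where
  "abs_cont_on X \<gamma>' \<gamma> \<longleftrightarrow> (\<forall>A \<subseteq> topspace X. \<gamma> A = 0 \<longrightarrow> \<gamma>' A = 0)"

definition gdelta_sigma_in :: "'a topology \<Rightarrow> 'a set \<Rightarrow> bool" where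
  "gdelta_sigma_in X = countable union_of gdelta_in X"

end

theory Submission
  imports Defs
begin

text \<open>
  If \<open>\<gamma>\<close> is not thin, a Cantor scheme whose nodes each contain uncountably many of the disjoint
  compact sets of capacity at least \<open>\<epsilon>\<close> yields a closed set \<open>C\<close> with a continuous map \<open>f\<close>
  onto the Cantor space all of whose fibres have capacity at least \<open>\<epsilon>\<close>. Then
  \<open>\<gamma>' A = sup\<^sub>x \<gamma> (A \<inter> f\<inverse>(x))\<close> is a subadditive capacity vanishing on \<open>\<gamma>\<close>-null sets and on
  sets meeting every fibre in a countable set. Let every \<open>x\<close> code a \<open>G\<^sub>\<delta>\<close>-set
  \<open>G\<^sub>x = (\<Inter>n. U\<^sub>n)\<close>. For each \<open>n\<close>, the union over \<open>x\<close> of the sets \<open>f\<inverse>(x) - U\<^sub>n\<close> is compact and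
  admits a \<open>G\<^sub>\<delta>\<close> selector \<open>M\<^sub>n\<close> with at most one point in each fibre. The union \<open>M\<close> of the
  \<open>M\<^sub>n\<close> is \<open>\<gamma>'\<close>-null, but a \<open>G\<^sub>\<delta>\<close>-set \<open>G\<^sub>x\<close> containing it must contain all of \<open>f\<inverse>(x)\<close>,
  so \<open>\<gamma>' G\<^sub>x \<ge> \<epsilon>\<close>. Part (i) follows, because \<open>\<gamma> (G - M) = 0\<close> would give \<open>\<gamma>' G = 0\<close>.
\<close>

section \<open>Countable bases of compact metrizable spaces\<close>

text \<open>By compactness, finitely many balls of radius \<open>inverse (Suc n)\<close> cover the
  space for each \<open>n\<close>; all these balls together form a base.\<close>

lemma compact_metrizable_imp_second_countable:
  assumes "compact_space X" "metrizable_space X"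
  shows "second_countable X"
proof -
  obtain M d where "Metric_space M d" and X: "X = Metric_space.mtopology M d"
    using assms(2) by (auto simp: metrizable_space_def)
  interpret Metric_space M d by fact
  have "\<exists>F. finite F \<and> F \<subseteq> M \<and> M \<subseteq> (\<Union>x\<in>F. mball x (inverse (Suc n)))" for n
  proof -
    have c: "compactin mtopology M"
      using assms(1) X by (simp add: compact_space_def)
    have "M \<subseteq> \<Union> ((\<lambda>x. mball x (inverse (Suc n))) ` M)"
      by auto
    then obtain \<F> where "finite \<F>" "\<F> \<subseteq> (\<lambda>x. mball x (inverse (Suc n))) ` M" "M \<subseteq> \<Union>\<F>"
      using c unfolding compactin_def by (smt (verit) image_iff openin_mball)
    then obtain F where "F \<subseteq> M" "finite F" "\<F> = (\<lambda>x. mball x (inverse (Suc n))) ` F"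
      by (meson finite_subset_image)
    with \<open>M \<subseteq> \<Union>\<F>\<close> show ?thesis
      by blast
  qed
  then obtain F where F: "\<And>n. finite (F n)" "\<And>n. F n \<subseteq> M"
      "\<And>n. M \<subseteq> (\<Union>x\<in>F n. mball x (inverse (Suc n)))"
    by metis
  define \<B> where "\<B> = (\<Union>n. (\<lambda>x. mball x (inverse (Suc n))) ` F n)"
  have "countable \<B>"
    unfolding \<B>_def using F(1) by (simp add: countable_finite)
  moreover have "\<forall>V\<in>\<B>. openin mtopology V"
    by (auto simp: \<B>_def)
  moreover have "\<exists>V\<in>\<B>. x \<in> V \<and> V \<subseteq> U" if U: "openin mtopology U" "x \<in> U" for U x
  proof -
    obtain r where r: "r > 0" "mball x r \<subseteq> U" and x: "x \<in> M"
      using U by (meson openin_mtopology subsetD)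
    obtain n where n: "inverse (Suc n) < r / 2"
      using r(1) reals_Archimedean half_gt_zero by blast
    obtain y where y: "y \<in> F n" "x \<in> mball y (inverse (Suc n))"
      using F(3)[of n] x by blast
    have "mball y (inverse (Suc n)) \<subseteq> mball x r"
    proof
      fix z assume z: "z \<in> mball y (inverse (Suc n))"
      have "d x z \<le> d x y + d y z"
        using x y z by (intro triangle) auto
      then show "z \<in> mball x r"
        using x y z n by (auto simp: commute)
    qed
    then show ?thesis
      using y r(2) by (auto simp: \<B>_def)
  qed
  ultimately show ?thesis
    unfolding second_countable_def X by (intro exI[of _ \<B>] conjI allI impI) simp_all
qed

lemma compact_metrizable_countable_base:
  fixes X :: "'a topology"
  assumes "compact_space X" "metrizable_space X"
  obtains B :: "nat \<Rightarrow> 'a set" where "\<And>n. openin X (B n)"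
    "\<And>U x. openin X U \<Longrightarrow> x \<in> U \<Longrightarrow> \<exists>n. x \<in> B n \<and> B n \<subseteq> U"
proof -
  obtain \<B> where B: "countable \<B>" "\<forall>V\<in>\<B>. openin X V"
      "\<forall>U x. openin X U \<and> x \<in> U \<longrightarrow> (\<exists>V\<in>\<B>. x \<in> V \<and> V \<subseteq> U)"
    using compact_metrizable_imp_second_countable[OF assms] unfolding second_countable_def by auto
  \<comment> \<open>Adding \<open>{}\<close> keeps the enumerated set nonempty even if
    \<open>\<B>\<close> is empty, so that \<open>b\<close> has exactly this set as its
    range.\<close>
  define b where "b = from_nat_into (insert {} \<B>)"
  have r: "range b = insert {} \<B>"
    unfolding b_def using B(1) by (intro range_from_nat_into) auto
  have "openin X (b n)" for n
  proof -
    have "b n \<in> insert {} \<B>"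
      using r by (metis rangeI)
    then show ?thesis
      using B(2) openin_empty by (metis insertE)
  qed
  moreover have "\<exists>n. x \<in> b n \<and> b n \<subseteq> U" if U: "openin X U" "x \<in> U" for U x
  proof -
    obtain V where "V \<in> \<B>" "x \<in> V" "V \<subseteq> U"
      using B(3) U by blast
    moreover from \<open>V \<in> \<B>\<close> have "V \<in> range b"
      unfolding r by simp
    ultimately show ?thesis
      by auto
  qed
  ultimately show thesis
    by (rule that[of b])
qed

text \<open>For a countable base there are only countably many such finite unions, yet they suffice
  as neighbourhoods of all compact sets.\<close>

lemma compactin_neighbourhood_finite_Union:
  assumes B: "\<And>n. openin X (B n)" "\<And>U x. openin X U \<Longrightarrow> x \<in> U \<Longrightarrow> \<exists>n. x \<in> B n \<and> B n \<subseteq> U"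
    and "compactin X K" "openin X W" "K \<subseteq> W"
  shows "\<exists>F. finite F \<and> K \<subseteq> \<Union>(B ` F) \<and> \<Union>(B ` F) \<subseteq> W"
proof -
  have "K \<subseteq> \<Union>(B ` {n. B n \<subseteq> W})"
    using B(2)[OF \<open>openin X W\<close>] \<open>K \<subseteq> W\<close> by blast
  then obtain \<F> where \<F>: "finite \<F>" "\<F> \<subseteq> B ` {n. B n \<subseteq> W}" "K \<subseteq> \<Union>\<F>"
    using \<open>compactin X K\<close> B(1) unfolding compactin_def by (smt (verit) image_iff)
  obtain F where "F \<subseteq> {n. B n \<subseteq> W}" "finite F" "\<F> = B ` F"
    using finite_subset_image[OF \<F>(1,2)] by blast
  with \<F>(3) show ?thesis
    by blast
qed

section \<open>Elementary properties of capacities\<close>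

lemma capacity_on_nonneg: "capacity_on X \<gamma> \<Longrightarrow> A \<subseteq> topspace X \<Longrightarrow> 0 \<le> \<gamma> A"
  and capacity_on_empty: "capacity_on X \<gamma> \<Longrightarrow> \<gamma> {} = 0"
  and capacity_on_mono: "capacity_on X \<gamma> \<Longrightarrow> A \<subseteq> B \<Longrightarrow> B \<subseteq> topspace X \<Longrightarrow> \<gamma> A \<le> \<gamma> B"
  and capacity_on_incseq: "capacity_on X \<gamma> \<Longrightarrow> incseq C \<Longrightarrow> (\<And>n. C n \<subseteq> topspace X) \<Longrightarrow>
    \<gamma> (\<Union>n. C n) = (SUP n. \<gamma> (C n))"
  and capacity_on_decseq: "capacity_on X \<gamma> \<Longrightarrow> decseq K \<Longrightarrow> (\<And>n. compactin X (K n)) \<Longrightarrow>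
    \<gamma> (\<Inter>n. K n) = (INF n. \<gamma> (K n))"
  by (simp_all add: capacity_on_def)

lemma subadditive_onD:
  "subadditive_on X \<gamma> \<Longrightarrow> A \<subseteq> topspace X \<Longrightarrow> B \<subseteq> topspace X \<Longrightarrow> \<gamma> (A \<union> B) \<le> \<gamma> A + \<gamma> B"
  by (simp add: subadditive_on_def)

section \<open>Branches and the coding map\<close>

definition branch :: "(bool \<Rightarrow> nat \<Rightarrow> 'a set) \<Rightarrow> (nat \<Rightarrow> bool) \<Rightarrow> 'a set" where
  "branch Z x = (\<Inter>n. Z (x n) n)"

text \<open>
  The map \<open>f\<close> is represented by the closed sets \<open>Z b n\<close> of points whose \<open>n\<close>th coordinate is \<open>b\<close>;
  its fibres are the branches, and below \<open>code\<close> is \<open>f\<close> on the domain \<open>carrier\<close>.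
\<close>

locale splitting =
  fixes X :: "'a topology" and Z :: "bool \<Rightarrow> nat \<Rightarrow> 'a set"
  assumes compact: "compact_space X" and metrizable: "metrizable_space X"
    and closedin_Z: "\<And>b n. closedin X (Z b n)"
    and disjoint: "\<And>n. Z True n \<inter> Z False n = {}"
begin

definition carrier :: "'a set" where
  "carrier = (\<Inter>n. Z True n \<union> Z False n)"

definition code :: "'a \<Rightarrow> nat \<Rightarrow> bool" where
  "code p n \<longleftrightarrow> p \<in> Z True n"

lemma closedin_branch: "closedin X (branch Z x)"
  unfolding branch_def by (intro closedin_INT closedin_Z) auto

lemma closedin_carrier: "closedin X carrier"
  unfolding carrier_def by (intro closedin_INT closedin_Un closedin_Z) auto

text \<open>By \<open>disjoint\<close>, a point of \<open>carrier\<close> determines its bit at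
  every level; so the branches are the fibres of \<open>code\<close> and pairwise disjoint.\<close>

lemma mem_branch_iff: "p \<in> branch Z x \<longleftrightarrow> p \<in> carrier \<and> code p = x"
proof -
  have "p \<in> Z (x n) n \<longleftrightarrow> (p \<in> Z True n \<or> p \<in> Z False n) \<and> code p n = x n" for n
    using disjoint[of n] by (cases "x n") (auto simp: code_def)
  then show ?thesis
    by (auto simp: branch_def carrier_def fun_eq_iff)
qed

lemma continuous_map_code:
  "continuous_map (subtopology X carrier) (product_topology (\<lambda>_. discrete_topology UNIV) UNIV) code"
proof -
  have "continuous_map (subtopology X carrier) (discrete_topology UNIV) (\<lambda>p. code p n)" for n
    unfolding continuous_map_closedin
  proof (intro conjI allI impI)
    fix C :: "bool set"
    let ?D = "(if True \<in> C then Z True n else {}) \<union> (if False \<in> C then Z False n else {})"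
    have "code p n \<in> C \<longleftrightarrow> p \<in> ?D" if "p \<in> carrier" for p
    proof -
      have "p \<in> Z True n \<or> p \<in> Z False n"
        using that by (auto simp: carrier_def)
      then show ?thesis
        using disjoint[of n] by (cases "p \<in> Z True n") (auto simp: code_def)
    qed
    then have "{p \<in> topspace (subtopology X carrier). code p n \<in> C} = carrier \<inter> ?D"
      using closedin_subset[OF closedin_carrier] by auto
    moreover have "closedin X ?D"
      by (intro closedin_Un) (auto simp: closedin_Z)
    ultimately show "closedin (subtopology X carrier) {p \<in> topspace (subtopology X carrier). code p n \<in> C}"
      by (simp add: closedin_subtopology_Int_closed)
  qed auto
  then show ?thesis
    by (simp add: continuous_map_componentwise_UNIV)
qed

section \<open>Saturation and G_delta selectors\<close>

text \<open>This is the saturation of \<open>A \<inter> carrier\<close> for the equivalence relation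
  of having the same code.\<close>

definition sat :: "'a set \<Rightarrow> 'a set" where
  "sat A = {p \<in> carrier. A \<inter> branch Z (code p) \<noteq> {}}"

text \<open>On \<open>carrier\<close>, \<open>code\<close> is a closed map, being continuous from a
  compact space to a Hausdorff space; the saturation is the preimage of the image.\<close>

lemma closedin_sat:
  assumes "closedin X A"
  shows "closedin X (sat A)"
proof -
  let ?Y = "product_topology (\<lambda>_. discrete_topology UNIV) UNIV :: (nat \<Rightarrow> bool) topology"
  have "Hausdorff_space ?Y"
    by (simp add: Hausdorff_space_product_topology)
  moreover have "compact_space (subtopology X carrier)"
    using compact closedin_carrier by (simp add: closedin_compact_space compact_space_subtopology)
  ultimately have "closed_map (subtopology X carrier) ?Y code"
    using continuous_map_code by (intro T1_Spaces.continuous_imp_closed_map)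
  then have "closedin ?Y (code ` (carrier \<inter> A))"
    using assms by (auto simp: closed_map_def closedin_subtopology_Int_closed)
  then have "closedin (subtopology X carrier)
      {p \<in> topspace (subtopology X carrier). code p \<in> code ` (carrier \<inter> A)}"
    by (rule closedin_continuous_map_preimage[OF continuous_map_code])
  moreover have "{p \<in> topspace (subtopology X carrier). code p \<in> code ` (carrier \<inter> A)} = sat A"
    using closedin_subset[OF closedin_carrier]
    by (auto simp: sat_def disjoint_iff mem_branch_iff image_iff Bex_def)
  ultimately show ?thesis
    using closedin_carrier closedin_trans_full by fastforce
qed

text \<open>
  In every fibre, step \<open>k\<close> intersects with \<open>E k\<close> if that leaves something; if the \<open>E k\<close> separate
  points, at most one point of each fibre survives all steps.
\<close>

primrec sel :: "'a set \<Rightarrow> (nat \<Rightarrow> 'a set) \<Rightarrow> nat \<Rightarrow> 'a set" where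
  "sel K E 0 = K"
| "sel K E (Suc k) = sel K E k \<inter> (E k \<union> (topspace X - sat (sel K E k \<inter> E k)))"

lemma sel_subset: "closedin X K \<Longrightarrow> sel K E k \<subseteq> topspace X"
  by (induction k) (auto dest: closedin_subset)

text \<open>A saturated set contains all of a branch or none of it, hence the dichotomy.\<close>

lemma sel_Suc_Int_branch:
  assumes "closedin X K"
  shows "sel K E (Suc k) \<inter> branch Z x =
    (if sel K E k \<inter> E k \<inter> branch Z x \<noteq> {} then sel K E k \<inter> E k \<inter> branch Z x
     else sel K E k \<inter> branch Z x)"
  using sel_subset[OF assms, of E k] by (auto simp: sat_def mem_branch_iff)

text \<open>Expresses stage \<open>Suc k\<close> through saturations at stage \<open>k\<close>, with
  closed sets again in place of \<open>A\<close> if \<open>A\<close> and \<open>E k\<close> are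
  closed. It is checked branch by branch, since \<open>sat\<close> need not commute with
  intersections.\<close>

lemma sat_sel_Suc:
  assumes "closedin X K"
  shows "sat (sel K E (Suc k) \<inter> A) =
    sat (sel K E k \<inter> (E k \<inter> A)) \<union> (sat (sel K E k \<inter> A) - sat (sel K E k \<inter> E k))"
proof -
  have "sel K E (Suc k) \<inter> A \<inter> branch Z x =
    (if sel K E k \<inter> E k \<inter> branch Z x \<noteq> {} then sel K E k \<inter> (E k \<inter> A) \<inter> branch Z x
     else sel K E k \<inter> A \<inter> branch Z x)" for x
    using sel_Suc_Int_branch[OF assms, of E k x] by (auto simp del: sel.simps split: if_splits)
  then show ?thesis
    by (auto simp: sat_def simp del: sel.simps)
qed

text \<open>Both classes are carried through the induction because removing an F_sigma set preserves
  G_delta and vice versa; \<open>A\<close> varies because the recursion replaces it by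
  \<open>E k \<inter> A\<close> and \<open>E k\<close>.\<close>

lemma gdelta_fsigma_sat_sel:
  assumes "closedin X K" "\<And>k. closedin X (E k)" "closedin X A"
  shows "gdelta_in X (sat (sel K E k \<inter> A)) \<and> fsigma_in X (sat (sel K E k \<inter> A))"
  using assms(3)
proof (induction k arbitrary: A)
  case 0
  then have "closedin X (sat (K \<inter> A))"
    using assms(1) by (intro closedin_sat) auto
  then show ?case
    by (simp add: closed_imp_fsigma_in closed_imp_gdelta_in metrizable)
next
  case (Suc k)
  then show ?case
    unfolding sat_sel_Suc[OF assms(1)]
    using assms(2) by (intro conjI gdelta_in_Un gdelta_in_diff fsigma_in_Un fsigma_in_diff) auto
qed

lemma gdelta_sel:
  assumes "closedin X K" "\<And>k. closedin X (E k)"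
  shows "gdelta_in X (sel K E k)"
proof (induction k)
  case 0
  then show ?case using assms(1) by (simp add: closed_imp_gdelta_in metrizable)
next
  case (Suc k)
  then show ?case
    using gdelta_fsigma_sat_sel[OF assms(1) _ assms(2), of E k k] assms(2)
    by (simp add: gdelta_in_Int gdelta_in_Un gdelta_in_diff closed_imp_gdelta_in metrizable assms(2))
qed

text \<open>The stages are G_delta sets globally, but closed on each branch, so compactness can be
  applied branch by branch.\<close>

lemma closedin_sel_Int_branch:
  assumes "closedin X K" "\<And>k. closedin X (E k)"
  shows "closedin X (sel K E k \<inter> branch Z x)"
proof (induction k)
  case 0
  then show ?case using assms(1) by (simp add: closedin_branch closedin_Int)
next
  case (Suc k)
  moreover have "closedin X (sel K E k \<inter> E k \<inter> branch Z x)"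
    using closedin_Int[OF assms(2)[of k] Suc] by (simp add: Int_ac)
  ultimately show ?case
    unfolding sel_Suc_Int_branch[OF assms(1)] by simp
qed

lemma sel_Int_branch_nonempty:
  assumes "closedin X K" "K \<inter> branch Z x \<noteq> {}"
  shows "sel K E k \<inter> branch Z x \<noteq> {}"
  using assms(2)
proof (induction k)
  case (Suc k)
  then show ?case
    unfolding sel_Suc_Int_branch[OF assms(1)] by simp
qed simp

text \<open>On a branch meeting \<open>K\<close> the stages leave nested nonempty closed sets, so a
  point survives; taking for \<open>E k\<close> the complements of a countable base leaves at most
  one.\<close>

lemma gdelta_selector:
  assumes K: "closedin X K"
  shows "\<exists>S. gdelta_in X S \<and> S \<subseteq> K \<and>
    (\<forall>x. (\<exists>p. S \<inter> branch Z x \<subseteq> {p}) \<and> (K \<inter> branch Z x \<noteq> {} \<longrightarrow> S \<inter> branch Z x \<noteq> {}))"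
proof -
  obtain B :: "nat \<Rightarrow> 'a set" where B: "\<And>n. openin X (B n)"
    "\<And>U x. openin X U \<Longrightarrow> x \<in> U \<Longrightarrow> \<exists>n. x \<in> B n \<and> B n \<subseteq> U"
    using compact_metrizable_countable_base[OF compact metrizable] by metis
  define E where "E k = topspace X - B k" for k
  have E: "closedin X (E k)" for k
    unfolding E_def using B(1) by (intro closedin_diff) auto
  define S where "S = (\<Inter>k. sel K E k)"
  have "gdelta_in X S"
    unfolding S_def using gdelta_sel[OF K E] by (intro gdelta_in_Inter) auto
  moreover have "S \<subseteq> K"
    by (metis INF_lower S_def UNIV_I sel.simps(1))
  moreover have "\<exists>p. S \<inter> branch Z x \<subseteq> {p}" for x
  proof -
    have "p = q" if p: "p \<in> S \<inter> branch Z x" and q: "q \<in> S \<inter> branch Z x" for p q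
    proof (rule ccontr)
      assume "p \<noteq> q"
      have X: "p \<in> topspace X" "q \<in> topspace X"
        using p q closedin_subset[OF closedin_branch] by blast+
      obtain U V where "openin X U" "p \<in> U" "openin X V" "q \<in> V" "U \<inter> V = {}"
        using metrizable_imp_Hausdorff_space[OF metrizable] X \<open>p \<noteq> q\<close>
        unfolding Hausdorff_space_def disjnt_def by metis
      then obtain k where k: "p \<in> B k" "q \<notin> B k"
        using B(2) by blast
      \<comment> \<open>Since \<open>q\<close> lies in \<open>E k\<close>, step \<open>k\<close>
        intersects this branch with \<open>E k\<close> and thereby removes \<open>p\<close>.\<close>
      have "p \<in> sel K E (Suc k) \<inter> branch Z x" "q \<in> sel K E (Suc k) \<inter> branch Z x"
        using p q unfolding S_def by blast+
      then show False
        using k X unfolding sel_Suc_Int_branch[OF K] by (auto simp: E_def split: if_splits)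
    qed
    then show ?thesis
      by blast
  qed
  moreover have "S \<inter> branch Z x \<noteq> {}" if "K \<inter> branch Z x \<noteq> {}" for x
  proof -
    have "(\<Inter>k. sel K E k \<inter> branch Z x) \<noteq> {}"
    proof (rule compact_space_imp_nest[OF compact])
      show "decseq (\<lambda>k. sel K E k \<inter> branch Z x)"
        by (intro decseq_SucI) auto
    qed (use closedin_sel_Int_branch[OF K E] sel_Int_branch_nonempty[OF K that] in auto)
    then show ?thesis
      by (auto simp: S_def)
  qed
  ultimately show ?thesis
    by (intro exI[of _ S] conjI allI impI)
qed

section \<open>Diagonalization over all G_delta sets\<close>

text \<open>Each \<open>x\<close> is read as a code of a sequence of open sets; on its own branch,
  \<open>M n\<close> picks a point outside the \<open>n\<close>th of them whenever there is
  one.\<close>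

lemma universal_selector:
  "\<exists>M. (\<forall>n::nat. gdelta_in X (M n)) \<and> (\<forall>n x. \<exists>p. M n \<inter> branch Z x \<subseteq> {p}) \<and>
    (\<forall>G. gdelta_in X G \<and> (\<Union>n. M n) \<subseteq> G \<longrightarrow> (\<exists>x. branch Z x \<subseteq> G))"
proof -
  obtain B :: "nat \<Rightarrow> 'a set" where B: "\<And>n. openin X (B n)"
    "\<And>U x. openin X U \<Longrightarrow> x \<in> U \<Longrightarrow> \<exists>n. x \<in> B n \<and> B n \<subseteq> U"
    using compact_metrizable_countable_base[OF compact metrizable] by metis
  \<comment> \<open>On \<open>branch Z x\<close>, the set \<open>K n\<close> omits exactly those
    \<open>B i\<close> for which bit \<open>prod_encode (n, i)\<close> of \<open>x\<close> is
    true.\<close>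
  define K where "K n = (\<Inter>i. Z False (prod_encode (n, i)) \<union> (topspace X - B i))" for n
  have "closedin X (K n)" for n
    unfolding K_def using B(1) closedin_Z by (intro closedin_INT closedin_Un) auto
  then have "\<forall>n. \<exists>S. gdelta_in X S \<and> S \<subseteq> K n \<and>
    (\<forall>x. (\<exists>p. S \<inter> branch Z x \<subseteq> {p}) \<and> (K n \<inter> branch Z x \<noteq> {} \<longrightarrow> S \<inter> branch Z x \<noteq> {}))"
    by (intro allI gdelta_selector)
  from choice[OF this] obtain M where
    *: "\<forall>n. gdelta_in X (M n) \<and> M n \<subseteq> K n \<and> (\<forall>x. (\<exists>p. M n \<inter> branch Z x \<subseteq> {p}) \<and>
      (K n \<inter> branch Z x \<noteq> {} \<longrightarrow> M n \<inter> branch Z x \<noteq> {}))" ..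
  then have M: "\<And>n. gdelta_in X (M n)" "\<And>n. M n \<subseteq> K n"
      "\<And>n x. \<exists>p. M n \<inter> branch Z x \<subseteq> {p}"
      "\<And>n x. K n \<inter> branch Z x \<noteq> {} \<Longrightarrow> M n \<inter> branch Z x \<noteq> {}"
    by simp_all
  have "\<exists>x. branch Z x \<subseteq> G" if G: "gdelta_in X G" "(\<Union>n. M n) \<subseteq> G" for G
  proof -
    obtain U :: "nat \<Rightarrow> 'a set" where U: "\<And>n. openin X (U n)" "(\<Inter>n. U n) = G"
      using G(1) unfolding gdelta_in_descending by blast
    \<comment> \<open>The code of \<open>G\<close>: it marks all basic sets inside
      \<open>U n\<close>, and these cover \<open>U n\<close>.\<close>
    define x where "x m = (case prod_decode m of (n, i) \<Rightarrow> B i \<subseteq> U n)" for m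
    have x: "x (prod_encode (n, i)) \<longleftrightarrow> B i \<subseteq> U n" for n i
      by (simp add: x_def)
    have K: "K n \<inter> branch Z x = branch Z x - U n" for n
    proof -
      have "p \<in> K n \<longleftrightarrow> (\<forall>i. B i \<subseteq> U n \<longrightarrow> p \<notin> B i)" if p: "p \<in> branch Z x" for p
      proof -
        have "p \<in> Z False m \<longleftrightarrow> \<not> x m" for m
        proof -
          have "p \<in> Z (x m) m"
            using p by (simp add: branch_def)
          then show ?thesis
            using disjoint[of m] by (cases "x m") auto
        qed
        moreover have "p \<in> topspace X"
          using p closedin_subset[OF closedin_branch] by blast
        ultimately show ?thesis
          by (auto simp: K_def x)
      qed
      then show ?thesis
        using B(2)[OF U(1)] by blast
    qed
    \<comment> \<open>Otherwise \<open>M n\<close> would contain a point of the branch outside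
      \<open>U n\<close>, although \<open>M n\<close> lies in \<open>G\<close> and hence in
      \<open>U n\<close>.\<close>
    have "branch Z x \<subseteq> U n" for n
      using K[of n] M(2)[of n] M(4)[of n x] G(2) U(2) by blast
    then show ?thesis
      using U(2) by blast
  qed
  then show ?thesis
    using M(1,3) by (intro exI[of _ M] conjI allI impI) simp_all
qed

section \<open>The fibrewise supremum of a capacity\<close>

lemma bdd_above_fibrewise:
  assumes "capacity_on X \<gamma>" "A \<subseteq> topspace X"
  shows "bdd_above (range (\<lambda>x. \<gamma> (A \<inter> branch Z x)))"
proof (rule bdd_aboveI2)
  show "\<gamma> (A \<inter> branch Z x) \<le> \<gamma> A" for x
    using assms by (intro capacity_on_mono) auto
qed

lemma fibrewise_upper:
  assumes "capacity_on X \<gamma>" "A \<subseteq> topspace X"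
  shows "\<gamma> (A \<inter> branch Z x) \<le> (SUP x. \<gamma> (A \<inter> branch Z x))"
  using bdd_above_fibrewise[OF assms] by (intro cSUP_upper) auto

lemma fibrewise_mono:
  assumes c: "capacity_on X \<gamma>" and "A \<subseteq> B" "B \<subseteq> topspace X"
  shows "(SUP x. \<gamma> (A \<inter> branch Z x)) \<le> (SUP x. \<gamma> (B \<inter> branch Z x))"
proof (rule cSUP_mono)
  show "\<exists>y\<in>UNIV. \<gamma> (A \<inter> branch Z x) \<le> \<gamma> (B \<inter> branch Z y)" for x
  proof -
    have "A \<inter> branch Z x \<subseteq> B \<inter> branch Z x" "B \<inter> branch Z x \<subseteq> topspace X"
      using assms by auto
    then show ?thesis
      using capacity_on_mono[OF c] by (intro bexI[of _ x]) simp_all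
  qed
qed (use bdd_above_fibrewise[OF c \<open>B \<subseteq> topspace X\<close>] in auto)

text \<open>A Koenig-type argument replaces compactness of the Cantor space: the bits of
  \<open>z\<close> are chosen one by one so that large fibres with this prefix exist for every
  \<open>n\<close>. Continuity of \<open>\<gamma>\<close> along decreasing compact sets then gives
  the bound at \<open>z\<close>.\<close>

lemma fibrewise_compact_lower:
  assumes c: "capacity_on X \<gamma>" and "decseq K" and K: "\<And>n. closedin X (K n)"
    and large: "\<And>n. \<exists>x. r \<le> \<gamma> (K n \<inter> branch Z x)"
  shows "\<exists>z. r \<le> \<gamma> ((\<Inter>n. K n) \<inter> branch Z z)"
proof -
  note mono = capacity_on_mono[OF c]
  \<comment> \<open>Only the first \<open>k\<close> bits of \<open>s\<close> matter, and the witness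
    \<open>x\<close> may depend on \<open>n\<close>.\<close>
  define good where
    "good k s \<longleftrightarrow> (\<forall>n. \<exists>x. (\<forall>i<k. x i = s i) \<and> r \<le> \<gamma> (K n \<inter> branch Z x))" for k and s :: "nat \<Rightarrow> bool"
  \<comment> \<open>If both extensions failed, they would fail at a common stage, as \<open>K\<close> is decreasing.\<close>
  have step: "\<exists>t. good (Suc k) t \<and> (\<forall>i<k. t i = s i)" if "good k s" for k s
  proof (rule ccontr)
    assume "\<not> ?thesis"
    then have "\<not> good (Suc k) (s(k := b))" for b
      by auto
    then obtain n where n: "\<And>b x. (\<forall>i<Suc k. x i = (s(k := b)) i) \<Longrightarrow> \<not> r \<le> \<gamma> (K (n b) \<inter> branch Z x)"
      unfolding good_def by metis
    obtain x where x: "\<forall>i<k. x i = s i" "r \<le> \<gamma> (K (max (n True) (n False)) \<inter> branch Z x)"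
      using \<open>good k s\<close> unfolding good_def by blast
    have "n (x k) \<le> max (n True) (n False)"
      by (cases "x k") auto
    then have "K (max (n True) (n False)) \<subseteq> K (n (x k))"
      using \<open>decseq K\<close> by (simp add: decseq_def)
    then have "r \<le> \<gamma> (K (n (x k)) \<inter> branch Z x)"
      using closedin_subset[OF K[of "n (x k)"]] by (intro order_trans[OF x(2)] mono) auto
    moreover have "\<forall>i<Suc k. x i = (s(k := x k)) i"
      using x(1) by (auto simp: less_Suc_eq)
    ultimately show False
      using n by blast
  qed
  have "good 0 (\<lambda>_. True)"
    using large by (simp add: good_def)
  then have "\<exists>s. \<forall>k. good k (s k) \<and> (\<forall>i<k. s (Suc k) i = s k i)"
    using step by (intro dependent_nat_choice) auto
  then obtain s where s: "\<And>k. good k (s k)" "\<And>k. \<forall>i<k. s (Suc k) i = s k i"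
    by auto
  \<comment> \<open>Bit \<open>i\<close> is fixed from stage \<open>Suc i\<close> onwards.\<close>
  define z where "z i = s (Suc i) i" for i
  have z: "s k i = z i" if "i < k" for i k
    using that
  proof (induction k)
    case (Suc k)
    then show ?case
      using s(2)[of k] by (cases "i = k") (auto simp: z_def)
  qed simp
  \<comment> \<open>Both the compact set and the prefix length advance with \<open>k\<close>; the
    witness for \<open>good k (s k)\<close> at \<open>n = k\<close> has its fibre in
    \<open>K k\<close> inside \<open>L k\<close>.\<close>
  define L where "L k = K k \<inter> (\<Inter>i<k. Z (z i) i)" for k
  have L: "compactin X (L k)" for k
  proof -
    have "closedin X (K n \<inter> (\<Inter>i<k. Z (z i) i))" for n
    proof (induction k)
      case (Suc k)
      have "closedin X ((K n \<inter> (\<Inter>i<k. Z (z i) i)) \<inter> Z (z k) k)"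
        by (intro closedin_Int Suc closedin_Z)
      then show ?case
        by (simp add: lessThan_Suc Int_ac)
    qed (simp add: K)
    then show ?thesis
      using compact by (simp add: L_def closedin_compact_space)
  qed
  have "r \<le> \<gamma> (L k)" for k
  proof -
    obtain x where x: "\<forall>i<k. x i = s k i" "r \<le> \<gamma> (K k \<inter> branch Z x)"
      using s(1)[of k] unfolding good_def by blast
    have "K k \<inter> branch Z x \<subseteq> L k"
    proof -
      have "branch Z x \<subseteq> Z (z i) i" if "i < k" for i
      proof -
        have "z i = x i"
          using x(1)[rule_format, OF that] z[OF that] by (rule trans[symmetric])
        then show ?thesis
          by (simp only: branch_def) (rule INF_lower, simp)
      qed
      then show ?thesis
        unfolding L_def by blast
    qed
    then have "\<gamma> (K k \<inter> branch Z x) \<le> \<gamma> (L k)"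
      by (rule mono) (rule compactin_subset_topspace[OF L])
    then show ?thesis
      using x(2) by linarith
  qed
  then have "r \<le> (INF k. \<gamma> (L k))"
    by (intro cINF_greatest) auto
  moreover have "decseq L"
  proof (rule decseq_SucI)
    show "L (Suc k) \<subseteq> L k" for k
      using \<open>decseq K\<close> decseq_SucD[of K k] by (auto simp: L_def lessThan_Suc)
  qed
  ultimately have "r \<le> \<gamma> (\<Inter>k. L k)"
    using capacity_on_decseq[OF c _ L] by simp
  moreover have "(\<Inter>k. L k) = (\<Inter>n. K n) \<inter> branch Z z"
    by (auto simp: L_def branch_def)
  ultimately show ?thesis
    by auto
qed

text \<open>Increasing unions reduce to an exchange of suprema; decreasing compact sets need
  \<open>fibrewise_compact_lower\<close>.\<close>

lemma capacity_on_fibrewise: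
  assumes c: "capacity_on X \<gamma>"
  shows "capacity_on X (\<lambda>A. SUP x. \<gamma> (A \<inter> branch Z x))" (is "capacity_on X ?g")
  unfolding capacity_on_def
proof (intro conjI allI impI)
  fix A assume "A \<subseteq> topspace X"
  \<comment> \<open>Any branch serves as a lower bound for the supremum; \<open>undefined\<close> is
    an arbitrary choice.\<close>
  then have "0 \<le> \<gamma> (A \<inter> branch Z undefined)"
    by (intro capacity_on_nonneg[OF c]) auto
  also have "\<dots> \<le> ?g A"
    using \<open>A \<subseteq> topspace X\<close> by (rule fibrewise_upper[OF c])
  finally show "0 \<le> ?g A" .
next
  show "?g {} = 0"
    using capacity_on_empty[OF c] by simp
next
  fix A B assume "A \<subseteq> B \<and> B \<subseteq> topspace X"
  then show "?g A \<le> ?g B"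
    using fibrewise_mono[OF c] by blast
next
  fix A :: "nat \<Rightarrow> 'a set" assume A: "incseq A \<and> (\<forall>n. A n \<subseteq> topspace X)"
  then have UA: "(\<Union>n. A n) \<subseteq> topspace X"
    by blast
  have g: "?g (A n) \<le> ?g (\<Union>n. A n)" for n
    using UA by (intro fibrewise_mono[OF c]) auto
  show "?g (\<Union>n. A n) = (SUP n. ?g (A n))"
  proof (rule antisym)
    show "?g (\<Union>n. A n) \<le> (SUP n. ?g (A n))"
    proof (rule cSUP_least)
      fix x
      have "\<gamma> (\<Union>n. A n \<inter> branch Z x) = (SUP n. \<gamma> (A n \<inter> branch Z x))"
      proof -
        have "incseq (\<lambda>n. A n \<inter> branch Z x)" "\<forall>n. A n \<inter> branch Z x \<subseteq> topspace X"
          using A by (auto simp: incseq_def)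
        then show ?thesis
          by (intro capacity_on_incseq[OF c]) auto
      qed
      also have "\<dots> \<le> (SUP n. ?g (A n))"
      proof (rule cSUP_least)
        fix n
        have "\<gamma> (A n \<inter> branch Z x) \<le> ?g (A n)"
          using A by (intro fibrewise_upper[OF c]) auto
        also have "\<dots> \<le> (SUP n. ?g (A n))"
          using g by (intro cSUP_upper bdd_aboveI2) auto
        finally show "\<gamma> (A n \<inter> branch Z x) \<le> (SUP n. ?g (A n))" .
      qed simp
      finally show "\<gamma> ((\<Union>n. A n) \<inter> branch Z x) \<le> (SUP n. ?g (A n))"
        by (simp add: Int_commute)
    qed simp
    show "(SUP n. ?g (A n)) \<le> ?g (\<Union>n. A n)"
      by (rule cSUP_least) (use g in auto)
  qed
next
  fix K :: "nat \<Rightarrow> 'a set" assume K: "decseq K \<and> (\<forall>n. compactin X (K n))"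
  have clK: "closedin X (K n)" for n
    using K metrizable metrizable_imp_Hausdorff_space compactin_imp_closedin by blast
  have K': "K n \<subseteq> topspace X" for n
    using clK closedin_subset by blast
  have g: "?g (\<Inter>n. K n) \<le> ?g (K n)" for n
    using K' by (intro fibrewise_mono[OF c]) auto
  show "?g (\<Inter>n. K n) = (INF n. ?g (K n))"
  proof (rule antisym)
    show "?g (\<Inter>n. K n) \<le> (INF n. ?g (K n))"
      using g by (intro cINF_greatest) auto
    show "(INF n. ?g (K n)) \<le> ?g (\<Inter>n. K n)"
    \<comment> \<open>Working with \<open>r\<close> strictly below the infimum yields for each
      \<open>n\<close> an actual fibre of capacity at least \<open>r\<close>, without knowing that
      the suprema are attained.\<close>
    proof (rule dense_le)
      fix r assume r: "r < (INF n. ?g (K n))"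
      have "\<exists>x. r \<le> \<gamma> (K n \<inter> branch Z x)" for n
      proof -
        have "(INF n. ?g (K n)) \<le> ?g (K n)"
          using g by (intro cINF_lower bdd_belowI2) auto
        with r have "r < ?g (K n)"
          by linarith
        then show ?thesis
          using less_cSUP_iff[OF _ bdd_above_fibrewise[OF c K'[of n]], of r] by (auto intro: less_imp_le)
      qed
      then obtain z where "r \<le> \<gamma> ((\<Inter>n. K n) \<inter> branch Z z)"
        using fibrewise_compact_lower[OF c] K clK by blast
      also have "\<dots> \<le> ?g (\<Inter>n. K n)"
        using K' by (intro fibrewise_upper[OF c]) auto
      finally show "r \<le> ?g (\<Inter>n. K n)" .
    qed
  qed
qed

lemma subadditive_on_fibrewise:
  assumes c: "capacity_on X \<gamma>" and "subadditive_on X \<gamma>"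
  shows "subadditive_on X (\<lambda>A. SUP x. \<gamma> (A \<inter> branch Z x))"
  unfolding subadditive_on_def
proof (intro allI impI cSUP_least)
  fix A B x assume AB: "A \<subseteq> topspace X \<and> B \<subseteq> topspace X"
  have "\<gamma> ((A \<union> B) \<inter> branch Z x) \<le> \<gamma> (A \<inter> branch Z x) + \<gamma> (B \<inter> branch Z x)"
  proof -
    have "A \<inter> branch Z x \<subseteq> topspace X" "B \<inter> branch Z x \<subseteq> topspace X"
      using AB by auto
    then show ?thesis
      unfolding Int_Un_distrib2 by (rule subadditive_onD[OF assms(2)])
  qed
  also have "\<dots> \<le> (SUP x. \<gamma> (A \<inter> branch Z x)) + (SUP x. \<gamma> (B \<inter> branch Z x))"
    using AB by (intro add_mono fibrewise_upper[OF c]) auto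
  finally show "\<gamma> ((A \<union> B) \<inter> branch Z x) \<le>
      (SUP x. \<gamma> (A \<inter> branch Z x)) + (SUP x. \<gamma> (B \<inter> branch Z x))" .
qed simp

lemma abs_cont_on_fibrewise:
  assumes c: "capacity_on X \<gamma>"
  shows "abs_cont_on X (\<lambda>A. SUP x. \<gamma> (A \<inter> branch Z x)) \<gamma>"
  unfolding abs_cont_on_def
proof (intro allI impI)
  fix A assume A: "A \<subseteq> topspace X" "\<gamma> A = 0"
  have "\<gamma> (A \<inter> branch Z x) = 0" for x
  proof (rule antisym)
    show "\<gamma> (A \<inter> branch Z x) \<le> 0"
      using capacity_on_mono[OF c _ A(1), of "A \<inter> branch Z x"] A(2) by simp
    show "0 \<le> \<gamma> (A \<inter> branch Z x)"
      using A(1) by (intro capacity_on_nonneg[OF c]) auto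
  qed
  then show "(SUP x. \<gamma> (A \<inter> branch Z x)) = 0"
    by simp
qed

end

section \<open>Countable unions of null sets\<close>

text \<open>Subadditivity makes the finite partial unions null, and continuity along increasing
  sequences passes to the whole union.\<close>

lemma capacity_null_UN:
  assumes c: "capacity_on X \<gamma>" and sub: "subadditive_on X \<gamma>"
    and A: "\<And>n::nat. A n \<subseteq> topspace X" "\<And>n. \<gamma> (A n) = 0"
  shows "\<gamma> (\<Union>n. A n) = 0"
proof -
  define B where "B n = (\<Union>i\<le>n. A i)" for n
  have B: "B n \<subseteq> topspace X" for n
    using A(1) by (auto simp: B_def)
  have "\<gamma> (B n) = 0" for n
  proof (induction n)
    case (Suc n)
    have "\<gamma> (B (Suc n)) \<le> \<gamma> (B n) + \<gamma> (A (Suc n))"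
    proof -
      have "B (Suc n) = B n \<union> A (Suc n)"
        by (auto simp: B_def atMost_Suc)
      then show ?thesis
        using subadditive_onD[OF sub B A(1)] by simp
    qed
    moreover have "0 \<le> \<gamma> (B (Suc n))"
      using B by (rule capacity_on_nonneg[OF c])
    ultimately show ?case
      using Suc A(2) by simp
  qed (simp add: B_def A(2))
  moreover have "incseq B"
    by (auto simp: B_def incseq_def intro: order_trans)
  then have "\<gamma> (\<Union>n. B n) = (SUP n. \<gamma> (B n))"
    using B by (intro capacity_on_incseq[OF c])
  moreover have "(\<Union>n. B n) = (\<Union>n. A n)"
    by (auto simp: B_def)
  ultimately show ?thesis
    by simp
qed

section \<open>A Cantor scheme from a capacity that is not thin\<close>

text \<open>A Cantor-Bendixson argument in the space of compact sets, where the sets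
  \<open>{L. L \<subseteq> W}\<close> with \<open>W\<close> open act as neighbourhoods.\<close>

lemma condensation_compact_sets:
  assumes "compact_space X" "metrizable_space X"
    and "uncountable \<S>" "\<And>K. K \<in> \<S> \<Longrightarrow> compactin X K"
  obtains \<T> where "\<T> \<subseteq> \<S>" "\<T> \<noteq> {}"
    "\<And>K W. K \<in> \<T> \<Longrightarrow> openin X W \<Longrightarrow> K \<subseteq> W \<Longrightarrow> uncountable {L \<in> \<T>. L \<subseteq> W}"
proof -
  obtain B where B: "\<And>n::nat. openin X (B n)"
    "\<And>U x. openin X U \<Longrightarrow> x \<in> U \<Longrightarrow> \<exists>n. x \<in> B n \<and> B n \<subseteq> U"
    using compact_metrizable_countable_base[OF assms(1,2)] by metis
  \<comment> \<open>These index the basic neighbourhoods with only countably many members; as there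
    are countably many finite \<open>F\<close>, only countably many sets are discarded.\<close>
  define \<N> where "\<N> = {F. finite F \<and> countable {L \<in> \<S>. L \<subseteq> \<Union>(B ` F)}}"
  define \<R> where "\<R> = (\<Union>F\<in>\<N>. {L \<in> \<S>. L \<subseteq> \<Union>(B ` F)})"
  have "countable \<N>"
    by (rule countable_subset[OF _ countable_Collect_finite]) (auto simp: \<N>_def)
  then have \<R>: "countable \<R>"
    unfolding \<R>_def by (intro countable_UN) (auto simp: \<N>_def)
  show thesis
  proof (rule that[of "\<S> - \<R>"])
    show "\<S> - \<R> \<noteq> {}"
      using uncountable_minus_countable[OF assms(3) \<R>] by force
    fix K W assume K: "K \<in> \<S> - \<R>" "openin X W" "K \<subseteq> W"
    obtain F where F: "finite F" "K \<subseteq> \<Union>(B ` F)" "\<Union>(B ` F) \<subseteq> W"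
      using compactin_neighbourhood_finite_Union[OF B, of K W] K assms(4) by blast
    then have "F \<notin> \<N>"
      using K(1) by (auto simp: \<R>_def)
    then have "uncountable {L \<in> \<S>. L \<subseteq> \<Union>(B ` F)}"
      using F(1) by (simp add: \<N>_def)
    then have "uncountable ({L \<in> \<S>. L \<subseteq> \<Union>(B ` F)} - \<R>)"
      using \<R> by (rule uncountable_minus_countable)
    moreover have "{L \<in> \<S>. L \<subseteq> \<Union>(B ` F)} - \<R> \<subseteq> {L \<in> \<S> - \<R>. L \<subseteq> W}"
      using F(3) by blast
    ultimately show "uncountable {L \<in> \<S> - \<R>. L \<subseteq> W}"
      using countable_subset by blast
  qed auto
qed

text \<open>Normality is used first to separate \<open>K\<close> from \<open>L\<close> and then to
  shrink the neighbourhoods until their closures are disjoint.\<close>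

lemma separate_compact_sets:
  assumes "compact_space X" "metrizable_space X"
    and "compactin X K" "compactin X L" "K \<inter> L = {}" "openin X W" "K \<subseteq> W" "L \<subseteq> W"
  obtains U V where "openin X U" "openin X V" "K \<subseteq> U" "L \<subseteq> V" "U \<subseteq> W" "V \<subseteq> W"
    "X closure_of U \<inter> X closure_of V = {}"
proof -
  have n: "normal_space X"
    using assms(2) by (rule metrizable_imp_normal_space)
  have cl: "closedin X K" "closedin X L"
    using assms(2-4) compactin_imp_closedin metrizable_imp_Hausdorff_space by blast+
  then obtain U V where UV: "openin X U" "openin X V" "K \<subseteq> U" "L \<subseteq> V" "disjnt U V"
    using n assms(5) unfolding normal_space_def disjnt_def by metis
  have nb: "\<exists>V. openin X V \<and> S \<subseteq> V \<and> X closure_of V \<subseteq> U" if "closedin X S" "openin X U" "S \<subseteq> U" for S U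
    using n that unfolding normal_space_alt by blast
  obtain U' where U': "openin X U'" "K \<subseteq> U'" "X closure_of U' \<subseteq> U \<inter> W"
    using nb[OF cl(1), of "U \<inter> W"] UV assms(6,7) by blast
  obtain V' where V': "openin X V'" "L \<subseteq> V'" "X closure_of V' \<subseteq> V \<inter> W"
    using nb[OF cl(2), of "V \<inter> W"] UV assms(6,8) by blast
  have "U' \<subseteq> X closure_of U'" "V' \<subseteq> X closure_of V'"
    using U'(1) V'(1) by (simp_all add: closure_of_subset openin_subset)
  with U' V' UV(5) show thesis
    by (intro that[of U' V']) (auto simp: disjnt_def)
qed

lemma not_thin_imp_splitting:
  assumes X: "compact_space X" "metrizable_space X" and c: "capacity_on X \<gamma>" and "\<not> thin_on X \<gamma>"
  obtains Z \<epsilon> where "splitting X Z" "\<epsilon> > 0" "\<And>x. \<epsilon> \<le> \<gamma> (branch Z x)"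
proof -
  note mono = capacity_on_mono[OF c]
  obtain \<K> where \<K>: "uncountable \<K>" "pairwise disjnt \<K>" "\<And>K. K \<in> \<K> \<Longrightarrow> compactin X K \<and> \<gamma> K > 0"
    using assms(4) unfolding thin_on_def by blast
  \<comment> \<open>Pigeonhole: countably many thresholds cover all positive capacities, so one of
    them is reached by uncountably many members.\<close>
  have "\<K> \<subseteq> (\<Union>m. {K \<in> \<K>. inverse (real (Suc m)) \<le> \<gamma> K})"
  proof
    fix K assume "K \<in> \<K>"
    then show "K \<in> (\<Union>m. {K \<in> \<K>. inverse (real (Suc m)) \<le> \<gamma> K})"
      using reals_Archimedean[of "\<gamma> K"] \<K>(3) by (auto intro: less_imp_le)
  qed
  then have "uncountable (\<Union>m. {K \<in> \<K>. inverse (real (Suc m)) \<le> \<gamma> K})"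
    using \<K>(1) countable_subset by blast
  then have "\<exists>m. uncountable {K \<in> \<K>. inverse (real (Suc m)) \<le> \<gamma> K}"
    by (rule contrapos_np) (auto intro!: countable_UN)
  then obtain m where m: "uncountable {K \<in> \<K>. inverse (real (Suc m)) \<le> \<gamma> K}" ..
  define \<epsilon> where "\<epsilon> = inverse (real (Suc m))"
  have S: "uncountable {K \<in> \<K>. \<epsilon> \<le> \<gamma> K}" "\<And>K. K \<in> {K \<in> \<K>. \<epsilon> \<le> \<gamma> K} \<Longrightarrow> compactin X K"
    using m \<K>(3) by (auto simp: \<epsilon>_def)
  obtain \<T> where \<T>: "\<T> \<subseteq> {K \<in> \<K>. \<epsilon> \<le> \<gamma> K}" "\<T> \<noteq> {}"
    "\<And>K W. K \<in> \<T> \<Longrightarrow> openin X W \<Longrightarrow> K \<subseteq> W \<Longrightarrow> uncountable {L \<in> \<T>. L \<subseteq> W}"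
    using condensation_compact_sets[OF X S] by metis
  have \<T>_compact: "compactin X K" if "K \<in> \<T>" for K
    using that \<T>(1) \<K>(3) by blast
  \<comment> \<open>Each good set can be split again: a member of \<open>\<T>\<close> inside
    \<open>W\<close> comes with uncountably many others inside \<open>W\<close>, which are disjoint
    from it.\<close>
  define good where "good W \<longleftrightarrow> openin X W \<and> (\<exists>K\<in>\<T>. K \<subseteq> W)" for W
  have "\<exists>V. good W \<longrightarrow> (\<forall>b::bool. good (V b) \<and> V b \<subseteq> W) \<and>
      X closure_of (V True) \<inter> X closure_of (V False) = {}" for W
  proof (cases "good W")
    case True
    then obtain K where K: "K \<in> \<T>" "K \<subseteq> W" and W: "openin X W"
      by (auto simp: good_def)
    have "uncountable ({L \<in> \<T>. L \<subseteq> W} - {K})"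
      using \<T>(3)[OF K(1) W K(2)] by (intro uncountable_minus_countable) auto
    then obtain L where L: "L \<in> \<T>" "L \<subseteq> W" "L \<noteq> K"
      by (metis (no_types, lifting) DiffE countable_empty ex_in_conv insertI1 mem_Collect_eq)
    have "K \<inter> L = {}"
      using \<K>(2) \<T>(1) K(1) L(1,3) unfolding pairwise_def disjnt_def by blast
    then obtain U V where UV: "openin X U" "openin X V" "K \<subseteq> U" "L \<subseteq> V" "U \<subseteq> W" "V \<subseteq> W"
      "X closure_of U \<inter> X closure_of V = {}"
      using separate_compact_sets[OF X \<T>_compact[OF K(1)] \<T>_compact[OF L(1)] _ W K(2) L(2)] by blast
    then have "good U" "good V"
      using K(1) L(1) by (auto simp: good_def)
    then show ?thesis
      using UV by (intro exI[of _ "\<lambda>b. if b then U else V"]) auto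
  qed simp
  then obtain V where V: "\<And>W b. good W \<Longrightarrow> good (V W b)" "\<And>W b. good W \<Longrightarrow> V W b \<subseteq> W"
    "\<And>W. good W \<Longrightarrow> X closure_of (V W True) \<inter> X closure_of (V W False) = {}"
    by metis
  \<comment> \<open>Addresses are lists with the newest bit at the head.\<close>
  define node where "node = rec_list (topspace X) (\<lambda>b _ W. V W b)"
  have node: "node [] = topspace X" "node (b # s) = V (node s) b" for b s
    by (simp_all add: node_def)
  have good: "good (node s)" for s
  proof (induction s)
    case Nil
    obtain K where "K \<in> \<T>"
      using \<T>(2) by blast
    then show ?case
      using compactin_subset_topspace[OF \<T>_compact] unfolding good_def node by blast
  qed (simp add: node V(1))
  define F where "F s = X closure_of (node s)" for s
  have F_Cons: "F (b # s) \<subseteq> F s" for b s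
    unfolding F_def node using V(2)[OF good] by (rule closure_of_mono)
  have F_closed: "closedin X (F s)" for s
    by (simp add: F_def)
  have F_large: "\<epsilon> \<le> \<gamma> (F s)" for s
  proof -
    obtain K where K: "K \<in> \<T>" "K \<subseteq> node s" "openin X (node s)"
      using good[of s] unfolding good_def by blast
    have "K \<subseteq> F s"
      unfolding F_def by (rule order_trans[OF K(2) closure_of_subset[OF openin_subset[OF K(3)]]])
    then have "\<gamma> K \<le> \<gamma> (F s)"
      using closedin_subset[OF F_closed] by (rule mono)
    then show ?thesis
      using \<T>(1) K(1) by auto
  qed
  have F_disjoint: "F s \<inter> F t = {}" if "length s = length t" "s \<noteq> t" for s t
    using that
  proof (induction s t rule: list_induct2)
    case (Cons b s c t)
    show ?case
    proof (cases "s = t")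
      case True
      with Cons.prems have "b \<noteq> c"
        by simp
      then show ?thesis
        using True V(3)[OF good[of t]] by (cases b; cases c) (auto simp: F_def node)
    next
      case False
      then show ?thesis
        using Cons.IH F_Cons by blast
    qed
  qed simp
  \<comment> \<open>The finite union of all nodes of depth \<open>Suc n\<close> whose newest bit is
    \<open>b\<close>; different addresses of equal length have disjoint sets.\<close>
  define Z where "Z b n = (\<Union>s\<in>{s. length s = n}. F (b # s))" for b n
  have "splitting X Z"
  proof
    fix b n
    have "finite {s :: bool list. length s = n}"
      using finite_lists_length_eq[of "UNIV :: bool set" n] by simp
    then show "closedin X (Z b n)"
      unfolding Z_def by (intro closedin_Union) (auto intro: F_closed)
  next
    fix n
    have "F (True # s) \<inter> F (False # t) = {}" if "length s = n" "length t = n" for s t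
      using that by (intro F_disjoint) auto
    then show "Z True n \<inter> Z False n = {}"
      unfolding Z_def by blast
  qed (fact X)+
  moreover have "\<epsilon> \<le> \<gamma> (branch Z x)" for x
  proof -
    \<comment> \<open>The first \<open>n\<close> bits of \<open>x\<close>, reversed to match the
      order of addresses.\<close>
    define p where "p n = rev (map x [0..<n])" for n
    have p: "p (Suc n) = x n # p n" "length (p n) = n" for n
      by (simp_all add: p_def)
    have "decseq (\<lambda>n. F (p n))"
      using F_Cons by (intro decseq_SucI) (simp add: p)
    moreover have "compactin X (F (p n))" for n
      using X(1) F_closed by (rule closedin_compact_space)
    ultimately have "\<gamma> (\<Inter>n. F (p n)) = (INF n. \<gamma> (F (p n)))"
      by (rule capacity_on_decseq[OF c])
    also have "\<epsilon> \<le> \<dots>"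
      using F_large by (intro cINF_greatest) auto
    finally have "\<epsilon> \<le> \<gamma> (\<Inter>n. F (p n))" .
    moreover have "(\<Inter>n. F (p n)) \<subseteq> branch Z x"
    proof -
      have "F (p (Suc n)) \<subseteq> Z (x n) n" for n
        using p by (auto simp: Z_def)
      then show ?thesis
        unfolding branch_def by blast
    qed
    moreover have "branch Z x \<subseteq> topspace X"
      using splitting.closedin_branch[OF \<open>splitting X Z\<close>] by (rule closedin_subset)
    ultimately show ?thesis
      using mono[of "\<Inter>n. F (p n)" "branch Z x"] by linarith
  qed
  moreover have "\<epsilon> > 0"
    by (simp add: \<epsilon>_def)
  ultimately show thesis
    using that by blast
qed

section \<open>The countable union of selectors and its two properties\<close>

theorem theorem1p2:
  fixes X :: "'a topology" and \<gamma> :: "'a set \<Rightarrow> real"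
  assumes "compact_space X" and "metrizable_space X"
    and "capacity_on X \<gamma>" and "subadditive_on X \<gamma>" and "nonatomic_on X \<gamma>"
    and "\<not> thin_on X \<gamma>"
  shows "\<exists>M. gdelta_sigma_in X M \<and>
           \<not> (\<exists>G. gdelta_in X G \<and> M \<subseteq> G \<and> \<gamma> (G - M) = 0) \<and>
           (\<exists>\<gamma>'. capacity_on X \<gamma>' \<and> subadditive_on X \<gamma>' \<and> abs_cont_on X \<gamma>' \<gamma> \<and>
                 \<gamma>' M = 0 \<and>
                 \<not> (\<exists>G. gdelta_in X G \<and> \<gamma>' G = 0 \<and> M \<subseteq> G))"
proof -
  obtain Z \<epsilon> where "splitting X Z" and \<epsilon>: "\<epsilon> > 0" "\<And>x. \<epsilon> \<le> \<gamma> (branch Z x)"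
    using not_thin_imp_splitting[OF assms(1-3,6)] by blast
  interpret splitting X Z by fact
  define \<gamma>' where "\<gamma>' A = (SUP x. \<gamma> (A \<inter> branch Z x))" for A
  have cap: "capacity_on X \<gamma>'" and sub: "subadditive_on X \<gamma>'" and ac: "abs_cont_on X \<gamma>' \<gamma>"
    unfolding \<gamma>'_def[abs_def] using assms(3,4)
    by (simp_all add: capacity_on_fibrewise subadditive_on_fibrewise abs_cont_on_fibrewise)
  from universal_selector obtain M where M: "\<forall>n::nat. gdelta_in X (M n)"
      "\<forall>n x. \<exists>p. M n \<inter> branch Z x \<subseteq> {p}"
      "\<forall>G. gdelta_in X G \<and> (\<Union>n. M n) \<subseteq> G \<longrightarrow> (\<exists>x. branch Z x \<subseteq> G)"
    by blast
  have M_subset: "M n \<subseteq> topspace X" for n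
    using M(1) gdelta_in_subset by blast
  have "\<gamma>' (M n) = 0" for n
  proof -
    have "\<gamma> (M n \<inter> branch Z x) = 0" for x
    proof -
      obtain p where "M n \<inter> branch Z x \<subseteq> {p}"
        using M(2) by blast
      \<comment> \<open>Non-atomicity enters here: each fibre of \<open>M n\<close> has at most one
        point and is therefore null.\<close>
      then consider "M n \<inter> branch Z x = {}" | "M n \<inter> branch Z x = {p}" "p \<in> topspace X"
        using M_subset[of n] by blast
      then show ?thesis
        using assms(3,5) by cases (auto simp: capacity_on_def nonatomic_on_def)
    qed
    then show ?thesis
      by (simp add: \<gamma>'_def)
  qed
  then have null: "\<gamma>' (\<Union>n. M n) = 0"
    by (intro capacity_null_UN[OF cap sub M_subset])
  have pos: "\<gamma>' G > 0" if G: "gdelta_in X G" "(\<Union>n. M n) \<subseteq> G" for G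
  proof -
    obtain x where "branch Z x \<subseteq> G"
      using M(3) G by blast
    then have "G \<inter> branch Z x = branch Z x"
      by blast
    then show ?thesis
      using \<epsilon> fibrewise_upper[OF assms(3) gdelta_in_subset[OF G(1)], of x]
      unfolding \<gamma>'_def by (metis order_less_le_trans)
  qed
  \<comment> \<open>A null difference would be \<open>\<gamma>'\<close>-null as well, and
    subadditivity would make \<open>G\<close> itself \<open>\<gamma>'\<close>-null, against
    \<open>pos\<close>.\<close>
  have "\<gamma> (G - (\<Union>n. M n)) \<noteq> 0" if G: "gdelta_in X G" "(\<Union>n. M n) \<subseteq> G" for G
  proof
    assume "\<gamma> (G - (\<Union>n. M n)) = 0"
    moreover have G': "G - (\<Union>n. M n) \<subseteq> topspace X"
      using gdelta_in_subset[OF G(1)] by blast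
    ultimately have "\<gamma>' (G - (\<Union>n. M n)) = 0"
      using ac unfolding abs_cont_on_def by blast
    moreover have "\<gamma>' ((\<Union>n. M n) \<union> (G - (\<Union>n. M n))) \<le> \<gamma>' (\<Union>n. M n) + \<gamma>' (G - (\<Union>n. M n))"
      using G' M_subset by (intro subadditive_onD[OF sub]) auto
    moreover have "(\<Union>n. M n) \<union> (G - (\<Union>n. M n)) = G"
      using G(2) by blast
    ultimately show False
      using null pos[OF G] by simp
  qed
  moreover have "gdelta_sigma_in X (\<Union>n. M n)"
    unfolding gdelta_sigma_in_def union_of_def using M(1) by (intro exI[of _ "range M"]) auto
  moreover have "\<not> (\<exists>G. gdelta_in X G \<and> \<gamma>' G = 0 \<and> (\<Union>n. M n) \<subseteq> G)"
    using pos by fastforce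
  ultimately show ?thesis
    using cap sub ac null by (intro exI[of _ "\<Union>n. M n"] conjI exI[of _ \<gamma>']) blast+
qed

end
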